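(* Let $S$ be a preordered semiring with $1>0$ and a power universal element $u\in S$. Then the test spectrum $\mathsf{TSper}(S)$ is a compact Hausdorff space.
   Context: All structures are commutative. A semiring is a set with operations $+,\cdot$ and elements $0,1$ such that $(S,+,0)$ and $(S,\cdot,1)$ are commutative monoids, multiplication distributes over addition, and $0\cdot x=0$. A semiring homomorphism preserves $+,\cdot,0,1$. A preordered semiring is a semiring $S$ with a reflexive and transitive relation $\le$ such that $x\le y$ implies $a+x\le a+y$ and $ax\le ay$ for all $a,x,y\in S$. Write $x<y$ for $x\le y$ and $y\not\le x$. A power universal element is a nonzero $u\in S$ with $u\ge 1$ such that for all nonzero $x,y\in S$ with $x\le y$ there is $k\in\mathbb{N}$ with $y\le xu^k$. $\mathbb{R}_+$ is the semiring of nonnegative reals with the usual operations and order; $\mathbb{TR}_+$ is the set of nonnegative reals with $\max$ as addition, the usual multiplication and the usual order. The test spectrum of $S$ is the disjoint union $$\mathsf{TSper}(S):=\{\text{monotone homomorphisms }\phi:S\to\mathbb{R}_+\}\ \sqcup\ \{\text{monotone homomorphisms }\phi:S\to\mathbb{TR}_+\text{ with }\phi(u)=e\},$$ where $e$ is Euler's number. It carries the weakest topology making the logarithmic evaluation maps $$\mathrm{lev}_x:\mathsf{TSper}(S)\to\mathbb{R},\qquad \phi\mapsto\frac{\log\phi(x)}{\log\phi(u)}$$ continuous for all nonzero $x\in S$. (These are well defined: every $\phi\in\mathsf{TSper}(S)$ satisfies $\phi(x)>0$ for all nonzero $x$ and $\phi(u)>1$.) *)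

theory Defs
  imports "HOL-Analysis.Analysis"
begin

text \<open>All semirings are commutative. The class below does not extend \<^class>\<open>comm_semiring_1\<close>,
  because the latter requires \<open>0 \<noteq> 1\<close>; nor does it extend the ordered classes of the library,
  because these require antisymmetry. The strict relation of \<^class>\<open>preorder\<close> is
  \<open>x \<le> y \<and> \<not> y \<le> x\<close>.\<close>

class preordered_semiring = comm_semiring_0 + comm_monoid_mult + preorder +
  assumes preordered_add_left_mono: "x \<le> y \<Longrightarrow> a + x \<le> a + y"
    and preordered_mult_left_mono: "x \<le> y \<Longrightarrow> a * x \<le> a * y"

definition power_universal :: "'a::preordered_semiring \<Rightarrow> bool" where
  "power_universal u \<longleftrightarrow> u \<noteq> 0 \<and> 1 \<le> u \<and>
     (\<forall>x y. x \<noteq> 0 \<longrightarrow> y \<noteq> 0 \<longrightarrow> x \<le> y \<longrightarrow> (\<exists>k::nat. y \<le> x * u ^ k))"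

text \<open>The semirings \<open>\<real>\<^sub>+\<close> and \<open>\<TT>\<real>\<^sub>+\<close> have the same carrier (the nonnegative reals), order and
  multiplication, and differ only in their addition, which is therefore passed as the
  argument \<open>add\<close>.\<close>

definition monotone_hom ::
    "(real \<Rightarrow> real \<Rightarrow> real) \<Rightarrow> ('a::preordered_semiring \<Rightarrow> real) \<Rightarrow> bool" where
  "monotone_hom add \<phi> \<longleftrightarrow>
     (\<forall>x. 0 \<le> \<phi> x) \<and>
     \<phi> 0 = 0 \<and> \<phi> 1 = 1 \<and>
     (\<forall>x y. \<phi> (x + y) = add (\<phi> x) (\<phi> y)) \<and>
     (\<forall>x y. \<phi> (x * y) = \<phi> x * \<phi> y) \<and>
     (\<forall>x y. x \<le> y \<longrightarrow> \<phi> x \<le> \<phi> y)"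

definition TSper ::
    "'a::preordered_semiring \<Rightarrow> (('a \<Rightarrow> real) + ('a \<Rightarrow> real)) set" where
  "TSper u = {\<phi>. monotone_hom (+) \<phi>} <+> {\<phi>. monotone_hom max \<phi> \<and> \<phi> u = exp 1}"

definition eval_at :: "('a \<Rightarrow> real) + ('a \<Rightarrow> real) \<Rightarrow> 'a \<Rightarrow> real" where
  "eval_at p x = (case p of Inl \<phi> \<Rightarrow> \<phi> x | Inr \<phi> \<Rightarrow> \<phi> x)"

definition lev :: "'a \<Rightarrow> 'a \<Rightarrow> ('a \<Rightarrow> real) + ('a \<Rightarrow> real) \<Rightarrow> real" where
  "lev u x p = ln (eval_at p x) / ln (eval_at p u)"

definition TSper_topology ::
    "'a::preordered_semiring \<Rightarrow> (('a \<Rightarrow> real) + ('a \<Rightarrow> real)) topology" where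
  "TSper_topology u =
     topology_generated_by {{p \<in> TSper u. lev u x p \<in> U} | x U. x \<noteq> 0 \<and> open U}"

text \<open>The next three facts say that this is the weakest topology on \<^const>\<open>TSper\<close> for which
  the maps \<^const>\<open>lev\<close> are continuous.\<close>

lemma topspace_TSper_topology:
  fixes u :: "'a::preordered_semiring"
  shows "topspace (TSper_topology u) = TSper u"
proof (cases "\<exists>x::'a. x \<noteq> 0")
  case True
  then obtain x :: 'a where "x \<noteq> 0" by blast
  then have "TSper u \<in> {{p \<in> TSper u. lev u x p \<in> U} | x U. x \<noteq> 0 \<and> open U}"
    by (auto intro!: exI[of _ x] exI[of _ UNIV])
  then show ?thesis
    unfolding TSper_topology_def topology_generated_by_topspace by blast
next
  case False
  then have "(1::'a) = 0" by blast
  then have "TSper u = {}"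
    by (auto simp: TSper_def monotone_hom_def)
  then show ?thesis
    unfolding TSper_topology_def topology_generated_by_topspace by blast
qed

lemma continuous_map_lev:
  fixes u x :: "'a::preordered_semiring"
  assumes "x \<noteq> 0"
  shows "continuous_map (TSper_topology u) euclideanreal (lev u x)"
  unfolding continuous_map_def topspace_TSper_topology
  using assms by (auto simp: TSper_topology_def intro!: topology_generated_by_Basis)

lemma TSper_topology_weakest:
  fixes u :: "'a::preordered_semiring"
  assumes "topspace T = TSper u"
    and "\<And>x. x \<noteq> 0 \<Longrightarrow> continuous_map T euclideanreal (lev u x)"
    and "openin (TSper_topology u) W"
  shows "openin T W"
proof -
  have "generate_topology_on {{p \<in> TSper u. lev u x p \<in> U} | x U. x \<noteq> 0 \<and> open U} W"
    using assms(3) by (simp add: TSper_topology_def openin_topology_generated_by_iff)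
  then show ?thesis
  proof induction
    case (Basis s)
    then show ?case
      using assms(1,2) by (auto simp: continuous_map_def)
  qed auto
qed

end

theory Submission
  imports Defs
begin

text \<open>The points of the test spectrum live on different scales: a real-valued homomorphism may take
  any value \<open>> 1\<close> at \<open>u\<close>, and a limit of real-valued homomorphisms may be tropical. Taking
  logarithms to base \<open>\<phi> u\<close> removes both difficulties. The function \<open>f x = log \<phi>(x) / log \<phi>(u)\<close> is
  monotone, turns products into sums, has \<open>f u = 1\<close>, and addition becomes
  \<open>f (x + y) = t log (exp (f x / t) + exp (f y / t))\<close> with \<open>t = 1 / log \<phi>(u)\<close> in the real case and
  \<open>f (x + y) = max (f x) (f y)\<close> in the tropical case. These two laws are one: the first operation
  extends continuously to \<open>t = 0\<close>, with value the maximum (Maslov dequantization; lemma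
  \<open>continuous_on_soft_max\<close>). Moreover the parameter \<open>t\<close> is visible in \<open>f\<close> itself, because
  \<open>f (1 + 1) = t log 2\<close>. So the functions \<open>f\<close> that arise are exactly the solutions of a family of
  closed conditions on finitely many coordinates each (\<open>log_point\<close>, with
  \<open>log_point_of_TSper\<close> and \<open>TSper_point_of\<close> for the two directions).

  Power universality bounds every coordinate: for nonzero \<open>x\<close> there are \<open>k\<close> and \<open>l\<close> with
  \<open>1 \<le> x u\<^sup>k\<close> and \<open>x \<le> u\<^sup>l\<close>, so \<open>-k \<le> f x \<le> l\<close>. Hence the solutions form a closed subset
  of a product of compact intervals, which is compact by Tychonoff's theorem, and the test spectrum
  is a continuous image of it. It is Hausdorff because \<open>f\<close> determines the point: \<open>f (1 + 1)\<close> decides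
  between the two kinds and gives \<open>\<phi> u\<close>, and then \<open>f x\<close> gives \<open>\<phi> x\<close>.\<close>

section \<open>The log-sum-exp operation and its tropical limit\<close>

text \<open>For \<open>t > 0\<close> this is \<open>t log (exp (a / t) + exp (b / t))\<close>. Factoring out the larger exponential
  makes the formula meaningful for \<open>t = 0\<close> too, where the second summand vanishes.\<close>

definition soft_max :: "real \<Rightarrow> real \<Rightarrow> real \<Rightarrow> real" where
  "soft_max t a b = max a b + t * ln (1 + exp (- \<bar>(a - b) / t\<bar>))"

lemma soft_max_zero [simp]: "soft_max 0 a b = max a b"
  by (simp add: soft_max_def)

lemma exp_soft_max:
  assumes "t > 0"
  shows "exp (soft_max t a b / t) = exp (a / t) + exp (b / t)"
proof -
  have *: "exp ((a + t * ln (1 + exp (- \<bar>(a - b) / t\<bar>))) / t) = exp (a / t) + exp (b / t)"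
    if "b \<le> a" for a b
  proof -
    have "0 < 1 + exp ((b - a) / t)"
      by (simp add: add_pos_pos)
    moreover have "- \<bar>(a - b) / t\<bar> = (b - a) / t"
      using assms that by (simp add: field_simps)
    moreover have "exp (a / t) * exp ((b - a) / t) = exp (b / t)"
      by (simp add: diff_divide_distrib flip: exp_add)
    ultimately show ?thesis
      using assms by (simp add: add_divide_distrib exp_add distrib_left)
  qed
  show ?thesis
  proof (cases "b \<le> a")
    case True
    then show ?thesis using *[of b a] by (simp add: soft_max_def max_def)
  next
    case False
    then have "\<bar>(a - b) / t\<bar> = \<bar>(b - a) / t\<bar>" "max a b = b"
      by (simp_all add: abs_minus_commute)
    then show ?thesis using False *[of a b] by (simp add: soft_max_def)
  qed
qed

lemma continuous_on_soft_max:
  fixes t a b :: "'b::topological_space \<Rightarrow> real"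
  assumes "continuous_on A t" "continuous_on A a" "continuous_on A b"
  shows "continuous_on A (\<lambda>z. soft_max (t z) (a z) (b z))"
  unfolding continuous_on_def
proof
  fix z assume "z \<in> A"
  then have lim: "(t \<longlongrightarrow> t z) (at z within A)" "(a \<longlongrightarrow> a z) (at z within A)"
      "(b \<longlongrightarrow> b z) (at z within A)"
    using assms by (auto simp: continuous_on_def)
  have "((\<lambda>z. t z * ln (1 + exp (- \<bar>(a z - b z) / t z\<bar>))) \<longlongrightarrow>
      t z * ln (1 + exp (- \<bar>(a z - b z) / t z\<bar>))) (at z within A)"
  proof (cases "t z = 0")
    case True
    \<comment> \<open>The quotient need not converge here, but the logarithm stays between \<open>0\<close> and \<open>ln 2\<close>.\<close>
    have "\<bar>ln (1 + exp (- \<bar>d\<bar>))\<bar> \<le> ln 2" for d :: real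
    proof -
      have "1 + exp (- \<bar>d\<bar>) \<le> 2" "1 \<le> 1 + exp (- \<bar>d\<bar>)"
        by simp_all
      then show ?thesis
        by (smt (verit) ln_ge_zero ln_mono)
    qed
    then have "\<forall>\<^sub>F y in at z within A.
        norm (t y * ln (1 + exp (- \<bar>(a y - b y) / t y\<bar>))) \<le> \<bar>t y\<bar> * ln 2"
      by (intro always_eventually allI, unfold real_norm_def abs_mult)
        (intro mult_left_mono abs_ge_zero)
    moreover have "((\<lambda>y. \<bar>t y\<bar> * ln 2) \<longlongrightarrow> 0) (at z within A)"
      using lim(1) True by (auto intro!: tendsto_eq_intros)
    ultimately show ?thesis
      using True by (simp add: Lim_null_comparison)
  next
    case False
    have "1 + exp (- \<bar>(a z - b z) / t z\<bar>) \<noteq> 0"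
      by (smt (verit) exp_gt_zero)
    then show ?thesis
      using False by (intro tendsto_intros lim)
  qed
  then show "((\<lambda>z. soft_max (t z) (a z) (b z)) \<longlongrightarrow> soft_max (t z) (a z) (b z)) (at z within A)"
    unfolding soft_max_def by (intro tendsto_add tendsto_max lim)
qed

section \<open>Positivity and bounds from power universality\<close>

context
  fixes u :: "'a::preordered_semiring"
  assumes zero_less_one: "(0::'a) < 1"
    and univ: "power_universal u"
begin

lemma nonneg: "(0::'a) \<le> x"
  using preordered_mult_left_mono[of 0 1 x] zero_less_one by (simp add: less_le_not_le)

lemma le_add_right: "(x::'a) \<le> x + y"
  using preordered_add_left_mono[OF nonneg, of x y] by simp

lemma not_one_le_zero: "\<not> (1::'a) \<le> 0"
  using zero_less_one by (simp add: less_le_not_le)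

lemma one_neq_zero: "(1::'a) \<noteq> 0"
  using not_one_le_zero nonneg[of 1] by metis

lemma u_nonzero: "u \<noteq> 0"
  using univ by (simp add: power_universal_def)

lemma one_add_nonzero: "1 + (x::'a) \<noteq> 0"
  using le_add_right[of 1 x] not_one_le_zero by metis

text \<open>A nonzero \<open>x\<close> need not be comparable to \<open>1\<close>, but both lie below \<open>1 + x\<close>, and power
  universality applies to each of these two pairs.\<close>

lemma nonzero_lower_bound:
  assumes "(x::'a) \<noteq> 0"
  shows "\<exists>k. 1 \<le> x * u ^ k"
proof -
  have "x \<le> 1 + x"
    using le_add_right[of x 1] by (simp add: add.commute)
  then obtain k where "1 + x \<le> x * u ^ k"
    using univ assms one_add_nonzero unfolding power_universal_def by blast
  then show ?thesis
    using le_add_right order_trans by blast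
qed

lemma upper_bound: "\<exists>k. x \<le> u ^ k"
proof -
  have "1 \<le> 1 + x"
    by (rule le_add_right)
  then obtain k where "1 + x \<le> 1 * u ^ k"
    using univ one_neq_zero one_add_nonzero unfolding power_universal_def by blast
  moreover have "x \<le> 1 + x"
    using le_add_right[of x 1] by (simp add: add.commute)
  ultimately show ?thesis
    using order_trans by auto
qed

lemma nonzero_mono:
  assumes "(x::'a) \<noteq> 0" "x \<le> y"
  shows "y \<noteq> 0"
proof
  assume "y = 0"
  obtain k where "1 \<le> x * u ^ k"
    using nonzero_lower_bound[OF assms(1)] by blast
  moreover have "x * u ^ k \<le> 0"
    using preordered_mult_left_mono[OF assms(2), of "u ^ k"] \<open>y = 0\<close> by (simp add: mult.commute)
  ultimately show False
    using not_one_le_zero order_trans by blast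
qed

lemma add_nonzero:
  "(x::'a) \<noteq> 0 \<Longrightarrow> x + y \<noteq> 0"
  using nonzero_mono le_add_right by blast

text \<open>Each nonzero \<open>x\<close> has a multiple \<open>x * u ^ k\<close> above \<open>1\<close>, so multiplication by it cannot send
  a nonzero element to \<open>0\<close>.\<close>

lemma mult_nonzero:
  assumes "(x::'a) \<noteq> 0" "y \<noteq> 0"
  shows "x * y \<noteq> 0"
proof
  assume "x * y = 0"
  obtain k where k: "1 \<le> x * u ^ k"
    using nonzero_lower_bound[OF assms(1)] by blast
  have "y * 1 \<le> y * (x * u ^ k)"
    using k by (rule preordered_mult_left_mono)
  also have "\<dots> = (x * y) * u ^ k"
    by (simp add: ac_simps)
  finally have "y \<le> 0"
    using \<open>x * y = 0\<close> by simp
  then show False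
    using nonzero_mono assms(2) by blast
qed

lemma hom_power:
  assumes "monotone_hom add \<phi>"
  shows "\<phi> (x ^ k) = \<phi> x ^ k"
  using assms by (induction k) (auto simp: monotone_hom_def)

lemma hom_pos:
  assumes hom: "monotone_hom add \<phi>" and "(x::'a) \<noteq> 0"
  shows "\<phi> x > 0"
proof -
  obtain k where "1 \<le> x * u ^ k"
    using nonzero_lower_bound[OF assms(2)] by blast
  then have "\<phi> 1 \<le> \<phi> (x * u ^ k)" "0 \<le> \<phi> x"
    using hom unfolding monotone_hom_def by blast+
  then have "1 \<le> \<phi> x * \<phi> u ^ k" "0 \<le> \<phi> x"
    using hom hom_power[OF hom, of u k] by (auto simp: monotone_hom_def)
  then show ?thesis
    by (cases "\<phi> x = 0") auto
qed

text \<open>The element \<open>1 + 1\<close> lies below a power of \<open>u\<close>, and an additive \<open>\<phi>\<close> maps it to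
  \<open>2\<close>; no power of a number \<open>\<le> 1\<close> reaches \<open>2\<close>.\<close>

lemma real_hom_u_gt_1:
  assumes hom: "monotone_hom (+) \<phi>"
  shows "\<phi> u > 1"
proof (rule ccontr)
  assume "\<not> \<phi> u > 1"
  moreover have "0 \<le> \<phi> u"
    using hom by (simp add: monotone_hom_def)
  ultimately have "\<phi> u ^ k \<le> 1" for k
    by (intro power_le_one) auto
  moreover obtain k where "1 + 1 \<le> u ^ k"
    using upper_bound by blast
  then have "\<phi> (1 + 1) \<le> \<phi> (u ^ k)"
    using hom unfolding monotone_hom_def by blast
  then have "2 \<le> \<phi> u ^ k"
    using hom hom_power[OF hom, of u k] by (simp add: monotone_hom_def)
  ultimately show False
    by (smt (verit))
qed

section \<open>Points of the test spectrum in logarithmic coordinates\<close>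

text \<open>The divisor \<open>ln 2\<close> recovers the parameter of the log-sum-exp operation, as
  \<open>soft_max t 0 0 = t * ln 2\<close>. The value at \<open>0\<close>, where the logarithm is meaningless, is a
  convention that keeps this coordinate bounded; as \<open>- \<infinity>\<close> would be the true value, monotonicity
  is asked only above nonzero elements.\<close>

definition log_point :: "('a \<Rightarrow> real) \<Rightarrow> bool" where
  "log_point f \<longleftrightarrow> f 0 = 0 \<and> f u = 1 \<and>
     (\<forall>x y. x \<noteq> 0 \<longrightarrow> y \<noteq> 0 \<longrightarrow> f (x * y) = f x + f y) \<and>
     (\<forall>x y. x \<noteq> 0 \<longrightarrow> x \<le> y \<longrightarrow> f x \<le> f y) \<and>
     (\<forall>x y. x \<noteq> 0 \<longrightarrow> y \<noteq> 0 \<longrightarrow> f (x + y) = soft_max (f (1 + 1) / ln 2) (f x) (f y))"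

definition TSper_log :: "('a \<Rightarrow> real) + ('a \<Rightarrow> real) \<Rightarrow> 'a \<Rightarrow> real" where
  "TSper_log p x = (if x = 0 then 0 else lev u x p)"

definition exp_hom :: "real \<Rightarrow> ('a \<Rightarrow> real) \<Rightarrow> 'a \<Rightarrow> real" where
  "exp_hom s f x = (if x = 0 then 0 else exp (s * f x))"

text \<open>The scale is forced: a tropical point has value \<open>exp 1\<close> at \<open>u\<close>, where \<open>f\<close> is \<open>1\<close>, and a real
  point has value \<open>2\<close> at \<open>1 + 1\<close>.\<close>

definition TSper_point :: "('a \<Rightarrow> real) \<Rightarrow> ('a \<Rightarrow> real) + ('a \<Rightarrow> real)" where
  "TSper_point f =
     (if f (1 + 1) = 0 then Inr (exp_hom 1 f) else Inl (exp_hom (ln 2 / f (1 + 1)) f))"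

lemma log_point_one:
  assumes "log_point f"
  shows "f 1 = 0"
proof -
  have "f (1 * 1) = f 1 + f 1"
    using assms one_neq_zero unfolding log_point_def by blast
  then show ?thesis by simp
qed

lemma log_point_two_nonneg:
  assumes "log_point f"
  shows "0 \<le> f (1 + 1)"
  using assms log_point_one[OF assms] le_add_right[of 1 1] one_neq_zero
  unfolding log_point_def by metis

lemma log_point_power:
  assumes "log_point f"
  shows "f (u ^ k) = real k \<and> u ^ k \<noteq> 0"
proof (induction k)
  case 0
  then show ?case using log_point_one[OF assms] one_neq_zero by simp
next
  case (Suc k)
  then show ?case
    using assms u_nonzero mult_nonzero unfolding log_point_def by simp
qed

text \<open>The bound does not depend on \<open>f\<close>, as compactness requires.\<close>

lemma log_points_bounded: "\<exists>B. \<forall>f. log_point f \<longrightarrow> \<bar>f x\<bar> \<le> B"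
proof (cases "x = 0")
  case True
  then show ?thesis by (auto simp: log_point_def)
next
  case False
  obtain k where k: "1 \<le> x * u ^ k"
    using nonzero_lower_bound[OF False] by blast
  obtain l where l: "x \<le> u ^ l"
    using upper_bound by blast
  have "\<bar>f x\<bar> \<le> real k + real l" if f: "log_point f" for f
  proof -
    have "f 1 \<le> f (x * u ^ k)" "f x \<le> f (u ^ l)"
      using f k l False one_neq_zero unfolding log_point_def by blast+
    moreover have "f (x * u ^ k) = f x + f (u ^ k)"
      using f False log_point_power[OF f] unfolding log_point_def by blast
    ultimately show ?thesis
      using log_point_power[OF f] log_point_one[OF f] by simp
  qed
  then show ?thesis by blast
qed

lemma compact_log_points: "compact {f. log_point f}"
proof -
  obtain B where B: "\<And>x f. log_point f \<Longrightarrow> \<bar>f x\<bar> \<le> B x"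
    using log_points_bounded by metis
  have "compactin (product_topology (\<lambda>_. euclidean) UNIV) (PiE UNIV (\<lambda>x. {- B x..B x}))"
    by (simp add: compactin_PiE)
  then have "compact (PiE UNIV (\<lambda>x. {- B x..B x}))"
    by (simp add: euclidean_product_topology)
  moreover have "closed {f. log_point f}"
    unfolding log_point_def
    by (intro closed_Collect_conj closed_Collect_all closed_Collect_imp closed_Collect_eq
        closed_Collect_le continuous_intros continuous_on_soft_max open_Collect_const) auto
  ultimately have "compact (PiE UNIV (\<lambda>x. {- B x..B x}) \<inter> {f. log_point f})"
    by (rule compact_Int_closed)
  moreover have "PiE UNIV (\<lambda>x. {- B x..B x}) \<inter> {f. log_point f} = {f. log_point f}"
    using B by (auto simp: abs_le_iff PiE_def Pi_def) (smt (verit) B)+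
  ultimately show ?thesis by simp
qed

text \<open>Both kinds of homomorphisms are governed by \<open>soft_max t\<close>, with \<open>t = 1 / ln (\<phi> u)\<close> in the real
  case and \<open>t = 0\<close> in the tropical one; the evaluation at \<open>1 + 1\<close> identifies this \<open>t\<close>.\<close>

lemma log_pointI:
  assumes hom: "monotone_hom add \<phi>" and u: "\<phi> u > 1"
    and f: "\<And>x. f x = (if x = 0 then 0 else ln (\<phi> x) / ln (\<phi> u))"
    and add: "\<And>x y. x \<noteq> 0 \<Longrightarrow> y \<noteq> 0 \<Longrightarrow> f (x + y) = soft_max t (f x) (f y)"
  shows "log_point f"
proof -
  have f1: "f 1 = 0"
    using hom by (simp add: f monotone_hom_def)
  have "f (1 + 1) / ln 2 = t"
    using add[OF one_neq_zero one_neq_zero] by (simp add: f1 soft_max_def)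
  then have "f (x + y) = soft_max (f (1 + 1) / ln 2) (f x) (f y)" if "x \<noteq> 0" "y \<noteq> 0" for x y
    using add that by simp
  moreover have "f (x * y) = f x + f y" if "x \<noteq> 0" "y \<noteq> 0" for x y
    using that hom_pos[OF hom that(1)] hom_pos[OF hom that(2)] mult_nonzero[OF that] hom
    by (simp add: f monotone_hom_def ln_mult add_divide_distrib)
  moreover have "f x \<le> f y" if "x \<noteq> 0" "x \<le> y" for x y
  proof -
    have "\<phi> x \<le> \<phi> y"
      using hom that by (simp add: monotone_hom_def)
    then show ?thesis
      using u hom_pos[OF hom that(1)] nonzero_mono[OF that] that
      by (simp add: f divide_right_mono)
  qed
  moreover have "f 0 = 0" "f u = 1"
    using u u_nonzero by (simp_all add: f)
  ultimately show ?thesis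
    unfolding log_point_def by blast
qed

lemma log_point_of_TSper:
  assumes "p \<in> TSper u"
  shows "log_point (TSper_log p)"
  using assms unfolding TSper_def
proof (rule PlusE)
  fix \<phi> assume p: "p = Inl \<phi>" and "\<phi> \<in> {\<phi>. monotone_hom (+) \<phi>}"
  then have hom: "monotone_hom (+) \<phi>" by simp
  note u = real_hom_u_gt_1[OF hom]
  have f: "TSper_log p x = (if x = 0 then 0 else ln (\<phi> x) / ln (\<phi> u))" for x
    by (simp add: TSper_log_def lev_def eval_at_def p)
  show ?thesis
  proof (rule log_pointI[OF hom u f])
    fix x y :: 'a assume xy: "x \<noteq> 0" "y \<noteq> 0"
    let ?t = "1 / ln (\<phi> u)"
    have t: "?t > 0" using u by simp
    have e: "exp (TSper_log p z / ?t) = \<phi> z" if "z \<noteq> 0" for z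
      using u that hom_pos[OF hom that] by (simp add: f)
    have "exp (TSper_log p (x + y) / ?t) = exp (soft_max ?t (TSper_log p x) (TSper_log p y) / ?t)"
      unfolding exp_soft_max[OF t] e[OF xy(1)] e[OF xy(2)] e[OF add_nonzero[OF xy(1)]]
      using hom by (simp add: monotone_hom_def)
    then show "TSper_log p (x + y) = soft_max ?t (TSper_log p x) (TSper_log p y)"
      using u by simp
  qed
next
  fix \<phi> assume p: "p = Inr \<phi>" and "\<phi> \<in> {\<phi>. monotone_hom max \<phi> \<and> \<phi> u = exp 1}"
  then have hom: "monotone_hom max \<phi>" and u: "\<phi> u = exp 1" by simp_all
  have f: "TSper_log p x = (if x = 0 then 0 else ln (\<phi> x) / ln (\<phi> u))" for x
    by (simp add: TSper_log_def lev_def eval_at_def p)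
  show ?thesis
  proof (rule log_pointI[OF hom _ f])
    show "\<phi> u > 1" by (simp add: u)
    fix x y :: 'a assume xy: "x \<noteq> 0" "y \<noteq> 0"
    have "\<phi> (x + y) = max (\<phi> x) (\<phi> y)"
      using hom by (simp add: monotone_hom_def)
    then show "TSper_log p (x + y) = soft_max 0 (TSper_log p x) (TSper_log p y)"
      using xy add_nonzero[OF xy(1)] hom_pos[OF hom xy(1)] hom_pos[OF hom xy(2)]
      by (simp add: f u max_def)
  qed
qed

text \<open>Only the additive law depends on the target semiring; the two kinds of points differ in the
  operation and the scale for which they satisfy it.\<close>

lemma monotone_hom_exp_hom:
  assumes f: "log_point f" and "s > 0"
    and add0: "\<And>a. a \<ge> 0 \<Longrightarrow> add a 0 = a" "\<And>a. a \<ge> 0 \<Longrightarrow> add 0 a = a"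
    and add: "\<And>x y. x \<noteq> 0 \<Longrightarrow> y \<noteq> 0 \<Longrightarrow> exp (s * f (x + y)) = add (exp (s * f x)) (exp (s * f y))"
  shows "monotone_hom add (exp_hom s f)"
  unfolding monotone_hom_def
proof (intro conjI allI impI)
  fix x y :: 'a
  show "0 \<le> exp_hom s f x" by (simp add: exp_hom_def)
  show "exp_hom s f 0 = 0" by (simp add: exp_hom_def)
  show "exp_hom s f 1 = 1"
    using log_point_one[OF f] one_neq_zero by (simp add: exp_hom_def)
  show "exp_hom s f (x + y) = add (exp_hom s f x) (exp_hom s f y)"
    using add0 add[of x y] add_nonzero[of x y] by (auto simp: exp_hom_def)
  show "exp_hom s f (x * y) = exp_hom s f x * exp_hom s f y"
    using f mult_nonzero[of x y]
    by (auto simp: exp_hom_def log_point_def distrib_left exp_add)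
  assume "x \<le> y"
  then show "exp_hom s f x \<le> exp_hom s f y"
    using f \<open>s > 0\<close> nonzero_mono[of x y] by (auto simp: exp_hom_def log_point_def)
qed

lemma TSper_point_of:
  assumes f: "log_point f"
  shows "TSper_point f \<in> TSper u" and "x \<noteq> 0 \<Longrightarrow> lev u x (TSper_point f) = f x"
proof -
  have add: "f (x + y) = soft_max (f (1 + 1) / ln 2) (f x) (f y)" if "x \<noteq> 0" "y \<noteq> 0" for x y
    using f that unfolding log_point_def by blast
  have fu: "f u = 1"
    using f unfolding log_point_def by blast
  show "TSper_point f \<in> TSper u"
  proof (cases "f (1 + 1) = 0")
    case True
    have "monotone_hom max (exp_hom 1 f)"
      by (rule monotone_hom_exp_hom[OF f]) (auto simp: add True max_def)
    then show ?thesis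
      using True fu u_nonzero by (simp add: TSper_point_def TSper_def exp_hom_def InrI)
  next
    case False
    then have c: "f (1 + 1) > 0"
      using log_point_two_nonneg[OF f] by simp
    have "monotone_hom (+) (exp_hom (ln 2 / f (1 + 1)) f)"
    proof (rule monotone_hom_exp_hom[OF f])
      fix x y :: 'a assume "x \<noteq> 0" "y \<noteq> 0"
      then show "exp (ln 2 / f (1 + 1) * f (x + y)) =
          exp (ln 2 / f (1 + 1) * f x) + exp (ln 2 / f (1 + 1) * f y)"
        using exp_soft_max[of "f (1 + 1) / ln 2" "f x" "f y"] c by (simp add: add mult.commute)
    qed (use c in auto)
    then show ?thesis
      using False by (simp add: TSper_point_def TSper_def InlI)
  qed
  show "lev u x (TSper_point f) = f x" if "x \<noteq> 0"
    using that fu u_nonzero by (simp add: TSper_point_def lev_def eval_at_def exp_hom_def)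
qed

section \<open>Compactness and separation\<close>

text \<open>The logarithmic coordinates determine the parameter of the point, hence its kind and its value
  at \<open>u\<close>, hence all of its values.\<close>

lemma TSper_point_TSper_log:
  assumes "p \<in> TSper u"
  shows "TSper_point (TSper_log p) = p"
  using assms unfolding TSper_def
proof (rule PlusE)
  fix \<phi> assume p: "p = Inl \<phi>" and "\<phi> \<in> {\<phi>. monotone_hom (+) \<phi>}"
  then have hom: "monotone_hom (+) \<phi>" by simp
  note u = real_hom_u_gt_1[OF hom]
  have "\<phi> (1 + 1) = 2" "\<phi> 0 = 0"
    using hom by (simp_all add: monotone_hom_def)
  then have two: "TSper_log p (1 + 1) = ln 2 / ln (\<phi> u)"
    by (simp add: TSper_log_def lev_def eval_at_def p one_add_nonzero)
  have "exp_hom (ln 2 / TSper_log p (1 + 1)) (TSper_log p) x = \<phi> x" for x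
    using u hom_pos[OF hom, of x] \<open>\<phi> 0 = 0\<close> unfolding two
    by (simp add: exp_hom_def TSper_log_def lev_def eval_at_def p)
  then show ?thesis
    using u two by (auto simp: TSper_point_def p)
next
  fix \<phi> assume p: "p = Inr \<phi>" and "\<phi> \<in> {\<phi>. monotone_hom max \<phi> \<and> \<phi> u = exp 1}"
  then have hom: "monotone_hom max \<phi>" and u: "\<phi> u = exp 1" by simp_all
  have "\<phi> (1 + 1) = 1" "\<phi> 0 = 0"
    using hom by (simp_all add: monotone_hom_def)
  then have two: "TSper_log p (1 + 1) = 0"
    by (simp add: TSper_log_def lev_def eval_at_def p)
  have "exp_hom 1 (TSper_log p) x = \<phi> x" for x
    using hom_pos[OF hom, of x] \<open>\<phi> 0 = 0\<close>
    by (simp add: exp_hom_def TSper_log_def lev_def eval_at_def p u)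
  then show ?thesis
    using two by (auto simp: TSper_point_def p)
qed

text \<open>Continuity need only be tested on the generators of the topology, which are conditions on one
  coordinate; so the discontinuous-looking case distinction in \<^const>\<open>TSper_point\<close> does no harm.\<close>

lemma continuous_map_TSper_point:
  "continuous_map (top_of_set {f. log_point f}) (TSper_topology u) TSper_point"
  unfolding TSper_topology_def
proof (rule continuous_on_generated_topo)
  fix W assume "W \<in> {{p \<in> TSper u. lev u x p \<in> U} | x U. x \<noteq> 0 \<and> open U}"
  then obtain x U where W: "W = {p \<in> TSper u. lev u x p \<in> U}" and "x \<noteq> 0" "open U"
    by blast
  \<comment> \<open>The preimage of a generator is the trace of an open cylinder.\<close>
  have "TSper_point -` W \<inter> {f. log_point f} = (\<lambda>f. f x) -` U \<inter> {f. log_point f}"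
    using \<open>x \<noteq> 0\<close> by (auto simp: W TSper_point_of)
  moreover have "open ((\<lambda>f. f x) -` U :: ('a \<Rightarrow> real) set)"
    using \<open>open U\<close> by (intro open_vimage continuous_intros) auto
  ultimately show "openin (top_of_set {f. log_point f})
      (TSper_point -` W \<inter> topspace (top_of_set {f. log_point f}))"
    by (auto simp: openin_open)
next
  have "TSper_point ` {f. log_point f} \<subseteq> topspace (TSper_topology u)"
    using TSper_point_of by (auto simp: topspace_TSper_topology)
  then show "TSper_point ` topspace (top_of_set {f. log_point f}) \<subseteq>
      \<Union> {{p \<in> TSper u. lev u x p \<in> U} | x U. x \<noteq> 0 \<and> open U}"
    unfolding TSper_topology_def topology_generated_by_topspace by simp
qed

lemma compact_space_TSper: "compact_space (TSper_topology u)"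
proof -
  have "TSper_point ` {f. log_point f} = TSper u"
  proof (intro equalityI subsetI)
    fix p assume "p \<in> TSper u"
    then show "p \<in> TSper_point ` {f. log_point f}"
      using TSper_point_TSper_log log_point_of_TSper by (metis image_eqI mem_Collect_eq)
  qed (use TSper_point_of in auto)
  moreover have "compactin (top_of_set {f. log_point f}) {f. log_point f}"
    using compact_log_points by (simp add: compactin_subtopology)
  ultimately have "compactin (TSper_topology u) (TSper u)"
    using image_compactin continuous_map_TSper_point by metis
  then show ?thesis
    by (simp add: compact_space_def topspace_TSper_topology)
qed

lemma Hausdorff_space_TSper: "Hausdorff_space (TSper_topology u)"
  unfolding Hausdorff_space_def topspace_TSper_topology
proof (intro allI impI)
  fix p q assume pq: "p \<in> TSper u \<and> q \<in> TSper u \<and> p \<noteq> q"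
  then have "TSper_log p \<noteq> TSper_log q"
    using TSper_point_TSper_log by metis
  then obtain x where "x \<noteq> 0" "lev u x p \<noteq> lev u x q"
    by (auto simp: TSper_log_def fun_eq_iff split: if_splits)
  then obtain U V where UV: "open U" "open V" "lev u x p \<in> U" "lev u x q \<in> V" "U \<inter> V = {}"
    using hausdorff[of "lev u x p" "lev u x q"] by blast
  have "openin (TSper_topology u) {r \<in> TSper u. lev u x r \<in> W}" if "open W" for W
    using openin_continuous_map_preimage[OF continuous_map_lev[OF \<open>x \<noteq> 0\<close>]] that
    by (simp add: topspace_TSper_topology)
  then show "\<exists>U V. openin (TSper_topology u) U \<and> openin (TSper_topology u) V \<and>
      p \<in> U \<and> q \<in> V \<and> disjnt U V"
    using UV pq
    by (intro exI[of _ "{r \<in> TSper u. lev u x r \<in> U}"] exI[of _ "{r \<in> TSper u. lev u x r \<in> V}"])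
      (auto simp: disjnt_def)
qed

end

theorem proposition7p9:
  fixes u :: "'a::preordered_semiring"
  assumes "(0::'a) < 1"
    and "power_universal u"
  shows "compact_space (TSper_topology u) \<and> Hausdorff_space (TSper_topology u)"
  using compact_space_TSper[OF assms] Hausdorff_space_TSper[OF assms] by blast

end
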